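(* Let $X\subset\mathbb F\mathbb P^n$ be a tight $t$-design with $t=2s-1$ odd and $s\ge 2$. For $0\le i\le s$ let $M_i=\left[P_i((x,y))\right]_{x,y\in X}$, and let $L_i$ be the idempotent positive multiple of $M_i$ (see context). Then $$\operatorname{rank} L_s\neq \operatorname{rank} L_1,$$ except in the case of a tight $5$-design in $\mathbb C\mathbb P^1$ (i.e. $\mathbb F=\mathbb C$, $n=1$, $t=5$).
   Context: Let $\mathbb F\in\{\mathbb R,\mathbb C,\mathbb H\}$ ($\mathbb H$ = quaternions), $m=\tfrac12\dim_{\mathbb R}\mathbb F$ (so $m=1/2,1,2$ respectively), $n\ge 1$, $N=m(n+1)$. $\mathbb F^{n+1}$ is the space of columns over $\mathbb F$ with scalars acting on the right; the inner product of $a,b$ is $a^*b$ ($a^*$ the conjugate transpose). $S^{2N-1}=\{a\in\mathbb F^{n+1}: a^*a=1\}$. The projective space $\mathbb F\mathbb P^n$ is the quotient of $S^{2N-1}$ by $a\sim a\lambda$ ($\lambda\in\mathbb F$, $|\lambda|=1$), with quotient map $a\mapsto \hat a$; for $x=\hat a$, $y=\hat b$ put $(x,y)=|a^*b|^2\in[0,1]$. For finite nonempty $X\subset\mathbb F\mathbb P^n$, the angle set is $A(X)=\{(x,y):x,y\in X,\ x\ne y\}$; put $s_X=|A(X)|$, $e=|A(X)\setminus\{0\}|$. Let $(\gamma)_i=\gamma(\gamma+1)\cdots(\gamma+i-1)$, $(\gamma)_0=1$. $P_i^{(\alpha,\beta)}$ denotes the classical Jacobi polynomial of degree $i$, orthogonal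 on $[-1,1]$ with respect to $(1-\tau)^\alpha(1+\tau)^\beta$ and normalized by $P_i^{(\alpha,\beta)}(1)=(\alpha+1)_i/i!$. Fix $\alpha=N-m-1$, $\beta=m-1$ and set $P_i(\xi)=P_i^{(\alpha,\beta)}(2\xi-1)$. A finite nonempty $X\subset\mathbb F\mathbb P^n$ is a $t$-design ($t\ge1$ an integer) if $\sum_{x\in X}P_i((x,y))=0$ for all $y\in X$ and $1\le i\le t$. A $t$-design is tight if $t=s_X+e$ (equivalently, as is known, $|X|=\frac{(N)_{s_X}(N-m+1)_e}{(m)_{s_X}\,e!}$); for a tight design with $t=2s-1$ one has $|A(X)|=s$, $0\in A(X)$. For such $X$ and $0\le i\le s$, $M_i^2$ is a positive real multiple $\kappa_i M_i$ of $M_i$, and $L_i:=\kappa_i^{-1}M_i$ is an idempotent matrix (its rank equals its trace). *)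

theory Defs
  imports
    "HOL-Analysis.Analysis"
    "HOL-Computational_Algebra.Polynomial"
    "Jordan_Normal_Form.DL_Rank"
begin

no_notation Finite_Cartesian_Product.vec.vec_nth (infixl "$" 90)

section \<open>Quaternions\<close>

datatype quat = Quat (qre: real) (qi: real) (qj: real) (qk: real)

lemma quat_eqI: "qre p = qre q \<Longrightarrow> qi p = qi q \<Longrightarrow> qj p = qj q \<Longrightarrow> qk p = qk q \<Longrightarrow> p = q"
  by (rule quat.expand) simp

lemma quat_eq_iff: "p = q \<longleftrightarrow> qre p = qre q \<and> qi p = qi q \<and> qj p = qj q \<and> qk p = qk q"
  by (auto intro: quat_eqI)

instantiation quat :: real_algebra_1
begin

definition zero_quat :: quat where "0 = Quat 0 0 0 0"
definition one_quat :: quat where "1 = Quat 1 0 0 0"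
definition plus_quat :: "quat \<Rightarrow> quat \<Rightarrow> quat" where
  "p + q = Quat (qre p + qre q) (qi p + qi q) (qj p + qj q) (qk p + qk q)"
definition uminus_quat :: "quat \<Rightarrow> quat" where
  "- p = Quat (- qre p) (- qi p) (- qj p) (- qk p)"
definition minus_quat :: "quat \<Rightarrow> quat \<Rightarrow> quat" where
  "p - q = Quat (qre p - qre q) (qi p - qi q) (qj p - qj q) (qk p - qk q)"
definition scaleR_quat :: "real \<Rightarrow> quat \<Rightarrow> quat" where
  "r *\<^sub>R p = Quat (r * qre p) (r * qi p) (r * qj p) (r * qk p)"
definition times_quat :: "quat \<Rightarrow> quat \<Rightarrow> quat" where
  "p * q = Quat
     (qre p * qre q - qi p * qi q - qj p * qj q - qk p * qk q)
     (qre p * qi q + qi p * qre q + qj p * qk q - qk p * qj q)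
     (qre p * qj q - qi p * qk q + qj p * qre q + qk p * qi q)
     (qre p * qk q + qi p * qj q - qj p * qi q + qk p * qre q)"

lemmas quat_simps = zero_quat_def one_quat_def plus_quat_def uminus_quat_def
  minus_quat_def scaleR_quat_def times_quat_def

instance
  by standard (simp_all add: quat_simps quat_eq_iff algebra_simps)

end

instantiation quat :: real_normed_div_algebra
begin

definition norm_quat :: "quat \<Rightarrow> real" where
  "norm q = sqrt ((qre q)\<^sup>2 + (qi q)\<^sup>2 + (qj q)\<^sup>2 + (qk q)\<^sup>2)"
definition sgn_quat :: "quat \<Rightarrow> quat" where "sgn (q :: quat) = q /\<^sub>R norm q"
definition dist_quat :: "quat \<Rightarrow> quat \<Rightarrow> real" where "dist (p :: quat) q = norm (p - q)"
definition uniformity_quat :: "(quat \<times> quat) filter" where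
  "uniformity = (INF e\<in>{0<..}. principal {(x :: quat, y). dist x y < e})"
definition open_quat :: "quat set \<Rightarrow> bool" where
  "open (U :: quat set) \<longleftrightarrow> (\<forall>x\<in>U. eventually (\<lambda>(x', y). x' = x \<longrightarrow> y \<in> U) uniformity)"
definition inverse_quat :: "quat \<Rightarrow> quat" where
  "inverse q = Quat (qre q) (- qi q) (- qj q) (- qk q) /\<^sub>R (norm q)\<^sup>2"
definition divide_quat :: "quat \<Rightarrow> quat \<Rightarrow> quat" where "p div (q :: quat) = p * inverse q"

instance
proof
  fix p q :: quat and r :: real
  have pow2: "(norm x)\<^sup>2 = (qre x)\<^sup>2 + (qi x)\<^sup>2 + (qj x)\<^sup>2 + (qk x)\<^sup>2" for x :: quat
    unfolding norm_quat_def by (simp add: add_nonneg_nonneg)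
  have norm_prod: "norm x = norm ((qre x, qi x), (qj x, qk x))" for x :: quat
    by (simp add: norm_quat_def norm_prod_def add_nonneg_nonneg add.assoc)
  show norm_0: "norm p = 0 \<longleftrightarrow> p = 0"
    by (simp add: norm_prod quat_eq_iff zero_quat_def zero_prod_def)
  show "norm (p + q) \<le> norm p + norm q"
    using norm_triangle_ineq[of "((qre p, qi p), (qj p, qk p))" "((qre q, qi q), (qj q, qk q))"]
    by (simp add: norm_prod plus_quat_def)
  show "norm (r *\<^sub>R p) = \<bar>r\<bar> * norm p"
    using norm_scaleR[of r "((qre p, qi p), (qj p, qk p))"]
    by (simp add: norm_prod scaleR_quat_def)
  have "(norm (p * q))\<^sup>2 = (norm p * norm q)\<^sup>2"
    unfolding power_mult_distrib pow2
    by (simp add: times_quat_def power2_eq_square algebra_simps)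
  then show "norm (p * q) = norm p * norm q"
    by (rule power2_eq_imp_eq) (simp_all add: norm_quat_def)
  have inv: "inverse p * p = 1 \<and> p * inverse p = 1" if "p \<noteq> 0"
  proof -
    define c where "c = inverse ((norm p)\<^sup>2)"
    have "(norm p)\<^sup>2 \<noteq> 0"
      using that norm_0 by simp
    then have "c * ((qre p)\<^sup>2 + (qi p)\<^sup>2 + (qj p)\<^sup>2 + (qk p)\<^sup>2) = 1"
      unfolding c_def pow2 by simp
    then have "c * qre p * qre p + c * qi p * qi p + c * qj p * qj p + c * qk p * qk p = 1"
      and "qre p * (c * qre p) + qi p * (c * qi p) + qj p * (c * qj p) + qk p * (c * qk p) = 1"
      by (simp_all add: power2_eq_square distrib_left mult.assoc mult.left_commute)
    moreover have "inverse p = Quat (c * qre p) (- (c * qi p)) (- (c * qj p)) (- (c * qk p))"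
      unfolding inverse_quat_def c_def by (simp add: scaleR_quat_def)
    ultimately show ?thesis
      by (simp add: quat_eq_iff times_quat_def one_quat_def)
  qed
  show "inverse p * p = 1" "p * inverse p = 1" if "p \<noteq> 0"
    using inv[OF that] by auto
  show "inverse (0 :: quat) = 0"
    by (simp add: inverse_quat_def quat_simps)
  show "p div q = p * inverse q"
    by (rule divide_quat_def)
  show "sgn p = p /\<^sub>R norm p"
    by (rule sgn_quat_def)
  show "dist p q = norm (p - q)"
    by (rule dist_quat_def)
  show "uniformity = (INF e\<in>{0<..}. principal {(x :: quat, y). dist x y < e})"
    by (rule uniformity_quat_def)
  show "open U \<longleftrightarrow> (\<forall>x\<in>U. eventually (\<lambda>(x', y). x' = x \<longrightarrow> y \<in> U) uniformity)" for U :: "quat set"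
    by (rule open_quat_def)
qed

end

definition quat_cnj :: "quat \<Rightarrow> quat" where
  "quat_cnj q = Quat (qre q) (- qi q) (- qj q) (- qk q)"

text \<open>The real numbers are \<^term>\<open>\<real> :: quat set\<close>, the complex numbers are
  \<open>quat_complexes\<close>, and the quaternions are \<^term>\<open>UNIV :: quat set\<close>.\<close>

definition quat_complexes :: "quat set" where
  "quat_complexes = {q. qj q = 0 \<and> qk q = 0}"

definition scalar_fields :: "quat set set" where
  "scalar_fields = {\<real>, quat_complexes, UNIV}"

section \<open>Projective spaces\<close>

text \<open>Scalars act on vectors from the right. The Hermitian product of \<open>a\<close> and \<open>b\<close> is
  \<open>a\<^sup>* b\<close>, conjugate-linear in the first argument; its value lies in \<open>F\<close> if all entries do.\<close>

definition herm_prod :: "quat vec \<Rightarrow> quat vec \<Rightarrow> quat" where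
  "herm_prod a b = (\<Sum>i<dim_vec a. quat_cnj (a $ i) * b $ i)"

definition unit_sphere :: "quat set \<Rightarrow> nat \<Rightarrow> quat vec set" where
  "unit_sphere F n = {a \<in> carrier_vec (n + 1). (\<forall>i<n + 1. a $ i \<in> F) \<and> herm_prod a a = 1}"

definition proj_rel :: "quat set \<Rightarrow> nat \<Rightarrow> (quat vec \<times> quat vec) set" where
  "proj_rel F n = {(a, b). a \<in> unit_sphere F n \<and> b \<in> unit_sphere F n \<and>
     (\<exists>c\<in>F. norm c = 1 \<and> b = map_vec (\<lambda>z. z * c) a)}"

definition proj_space :: "quat set \<Rightarrow> nat \<Rightarrow> quat vec set set" where
  "proj_space F n = unit_sphere F n // proj_rel F n"

definition proj_prod :: "quat vec set \<Rightarrow> quat vec set \<Rightarrow> real" where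
  "proj_prod x y = (THE r. \<exists>a\<in>x. \<exists>b\<in>y. r = (norm (herm_prod a b))\<^sup>2)"

lemma proj_prod_class:
  assumes F: "F \<in> scalar_fields" and ab: "a \<in> unit_sphere F n" "b \<in> unit_sphere F n"
  shows "proj_prod (proj_rel F n `` {a}) (proj_rel F n `` {b}) = (norm (herm_prod a b))\<^sup>2"
proof -
  have cnj_mult: "quat_cnj (p * q) = quat_cnj q * quat_cnj p" for p q
    by (simp add: quat_cnj_def times_quat_def algebra_simps)
  have norm_cnj: "norm (quat_cnj p) = norm p" for p
    by (simp add: quat_cnj_def norm_quat_def)
  have dims: "dim_vec a = n + 1" "dim_vec b = n + 1"
    using ab by (auto simp: unit_sphere_def)
  have eq: "norm (herm_prod a' b') = norm (herm_prod a b)"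
    if a': "(a, a') \<in> proj_rel F n" and b': "(b, b') \<in> proj_rel F n" for a' b'
  proof -
    obtain c where c: "norm c = 1" "a' = map_vec (\<lambda>z. z * c) a"
      using a' unfolding proj_rel_def by blast
    obtain d where d: "norm d = 1" "b' = map_vec (\<lambda>z. z * d) b"
      using b' unfolding proj_rel_def by blast
    have "herm_prod a' b' = quat_cnj c * herm_prod a b * d"
      unfolding herm_prod_def c(2) d(2)
      by (simp add: dims sum_distrib_left sum_distrib_right cnj_mult mult.assoc del: sum.lessThan_Suc)
    then show ?thesis
      by (simp add: norm_mult norm_cnj c(1) d(1))
  qed
  have "1 \<in> F"
    using F
    by (auto simp: scalar_fields_def quat_complexes_def) (simp_all add: one_quat_def)
  moreover have "v = map_vec (\<lambda>z. z * 1) v" for v :: "quat vec"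
    by auto
  ultimately have refl: "(v, v) \<in> proj_rel F n" if "v \<in> unit_sphere F n" for v
    using that unfolding proj_rel_def by (auto intro!: bexI[of _ 1])
  show ?thesis
    unfolding proj_prod_def
  proof (rule the_equality)
    show "\<exists>a'\<in>proj_rel F n `` {a}. \<exists>b'\<in>proj_rel F n `` {b}.
        (norm (herm_prod a b))\<^sup>2 = (norm (herm_prod a' b'))\<^sup>2"
      using refl[OF ab(1)] refl[OF ab(2)] by blast
  qed (use eq in auto)
qed

section \<open>Jacobi polynomials\<close>

definition jacobi :: "real \<Rightarrow> real \<Rightarrow> nat \<Rightarrow> real poly" where
  "jacobi \<alpha> \<beta> i = (THE p. degree p = i \<and>
     (\<forall>q. degree q < i \<longrightarrow>
        integral {-1..1} (\<lambda>\<tau>. poly p \<tau> * poly q \<tau> * ((1 - \<tau>) powr \<alpha> * (1 + \<tau>) powr \<beta>)) = 0) \<and>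
     poly p 1 = pochhammer (\<alpha> + 1) i / fact i)"

definition half_dim :: "quat set \<Rightarrow> real" where
  "half_dim F = real (dim F) / 2"

lemma half_dim_scalar_fields:
  "half_dim \<real> = 1 / 2" "half_dim quat_complexes = 1" "half_dim UNIV = 2"
proof -
  have lin: "x *\<^sub>R Quat 1 0 0 0 + (y *\<^sub>R Quat 0 1 0 0 + (z *\<^sub>R Quat 0 0 1 0 + w *\<^sub>R Quat 0 0 0 1))
      = Quat x y z w" for x y z w
    by (simp add: quat_simps)
  have indep: "independent {Quat 1 0 0 0, Quat 0 1 0 0, Quat 0 0 1 0, Quat 0 0 0 1}"
  proof (rule independent_if_scalars_zero)
    fix f :: "quat \<Rightarrow> real" and q
    let ?B = "{Quat 1 0 0 0, Quat 0 1 0 0, Quat 0 0 1 0, Quat 0 0 0 1}"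
    assume "(\<Sum>x\<in>?B. f x *\<^sub>R x) = 0" and q: "q \<in> ?B"
    moreover have "(\<Sum>x\<in>?B. f x *\<^sub>R x) = Quat (f (Quat 1 0 0 0)) (f (Quat 0 1 0 0))
        (f (Quat 0 0 1 0)) (f (Quat 0 0 0 1))"
      unfolding lin[symmetric, of "f (Quat 1 0 0 0)"] by simp
    ultimately have "f (Quat 1 0 0 0) = 0 \<and> f (Quat 0 1 0 0) = 0 \<and> f (Quat 0 0 1 0) = 0
        \<and> f (Quat 0 0 0 1) = 0"
      unfolding zero_quat_def by (metis quat.inject)
    then show "f q = 0"
      using q by blast
  qed simp
  have "x *\<^sub>R Quat 1 0 0 0 + (y *\<^sub>R Quat 0 1 0 0 + (z *\<^sub>R Quat 0 0 1 0 + w *\<^sub>R Quat 0 0 0 1))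
      \<in> span {Quat 1 0 0 0, Quat 0 1 0 0, Quat 0 0 1 0, Quat 0 0 0 1}" for x y z w
    by (intro span_add span_scale span_base) simp_all
  then have "Quat x y z w \<in> span {Quat 1 0 0 0, Quat 0 1 0 0, Quat 0 0 1 0, Quat 0 0 0 1}" for x y z w
    by (simp only: lin)
  then have sp4: "span {Quat 1 0 0 0, Quat 0 1 0 0, Quat 0 0 1 0, Quat 0 0 0 1} = UNIV"
    by (metis UNIV_eq_I quat.exhaust)
  have "x *\<^sub>R Quat 1 0 0 0 + y *\<^sub>R Quat 0 1 0 0 \<in> span {Quat 1 0 0 0, Quat 0 1 0 0}" for x y
    by (intro span_add span_scale span_base) simp_all
  moreover have "x *\<^sub>R Quat 1 0 0 0 + y *\<^sub>R Quat 0 1 0 0 = Quat x y 0 0" for x y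
    by (simp add: quat_simps)
  ultimately have "Quat x y 0 0 \<in> span {Quat 1 0 0 0, Quat 0 1 0 0}" for x y
    by (simp only:)
  then have sp2: "quat_complexes \<subseteq> span {Quat 1 0 0 0, Quat 0 1 0 0}"
    unfolding quat_complexes_def by (metis (mono_tags, lifting) mem_Collect_eq quat.collapse subsetI)
  have sp1: "\<real> \<subseteq> span {Quat 1 0 0 0}"
    unfolding Reals_def of_real_def one_quat_def by (auto intro: span_scale[OF span_base])
  have indep2: "independent {Quat 1 0 0 0, Quat 0 1 0 0}" and indep1: "independent {Quat 1 0 0 0}"
    by (rule independent_mono[OF indep]; blast)+
  have one_real: "Quat 1 0 0 0 \<in> \<real>"
    unfolding one_quat_def[symmetric] by simp
  have "dim (UNIV :: quat set) = 4"
    by (rule dim_unique[of "{Quat 1 0 0 0, Quat 0 1 0 0, Quat 0 0 1 0, Quat 0 0 0 1}"])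
      (use indep sp4 in auto)
  moreover have "dim quat_complexes = 2"
    by (rule dim_unique[of "{Quat 1 0 0 0, Quat 0 1 0 0}"])
      (use sp2 indep2 in \<open>auto simp: quat_complexes_def\<close>)
  moreover have "dim (\<real> :: quat set) = 1"
    by (rule dim_unique[of "{Quat 1 0 0 0}"])
      (use sp1 one_real indep1 in \<open>simp_all del: independent_insert dependent_single\<close>)
  ultimately show "half_dim \<real> = 1 / 2" "half_dim quat_complexes = 1" "half_dim UNIV = 2"
    by (simp_all add: half_dim_def)
qed

definition zonal :: "quat set \<Rightarrow> nat \<Rightarrow> nat \<Rightarrow> real \<Rightarrow> real" where
  "zonal F n i \<xi> =
     (let m = half_dim F; N = m * (real n + 1)
      in poly (jacobi (N - m - 1) (m - 1) i) (2 * \<xi> - 1))"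

section \<open>Designs\<close>

definition angle_set :: "quat vec set set \<Rightarrow> real set" where
  "angle_set X = {proj_prod x y | x y. x \<in> X \<and> y \<in> X \<and> x \<noteq> y}"

definition design :: "quat set \<Rightarrow> nat \<Rightarrow> nat \<Rightarrow> quat vec set set \<Rightarrow> bool" where
  "design F n t X \<longleftrightarrow> finite X \<and> X \<noteq> {} \<and> X \<subseteq> proj_space F n \<and> t \<ge> 1 \<and>
     (\<forall>y\<in>X. \<forall>i\<in>{1..t}. (\<Sum>x\<in>X. zonal F n i (proj_prod x y)) = 0)"

definition tight_design :: "quat set \<Rightarrow> nat \<Rightarrow> nat \<Rightarrow> quat vec set set \<Rightarrow> bool" where
  "tight_design F n t X \<longleftrightarrow> design F n t X \<and>
     t = card (angle_set X) + card (angle_set X - {0})"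

text \<open>Matrices indexed by a finite set of points are taken with respect to an enumeration
  \<open>xs\<close> of that set.\<close>

definition zonal_mat :: "quat set \<Rightarrow> nat \<Rightarrow> quat vec set list \<Rightarrow> nat \<Rightarrow> real mat" where
  "zonal_mat F n xs i =
     mat (length xs) (length xs) (\<lambda>(j, k). zonal F n i (proj_prod (xs ! j) (xs ! k)))"

end

(* A tight (2s-1)-design has s angles, one of them 0. Seen from a point of X, the angles together
   with 1 are therefore the nodes of a Gauss-Lobatto rule for the Beta weight, exact up to degree
   2s-1. The rank of the idempotent L_i is its trace, |X| P_i(1)^2 divided by the sum of P_i^2 over X.
   This sum is computed from exactness for i = 1 and from the error term of the rule for i = s. With
   r = s-1, equality of the two ranks becomes
     (N)_r (N-m+1)_r = (N+1) r! (m+1)_r,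
   where the left side outgrows the right in n and r, so that only small cases remain. *)

theory Submission
  imports Defs
begin

text \<open>The difficulty sits at i = s: P_s^2 has degree 2s, one more than the design controls.
  The s - 1 nodes other than 0 and 1, and the multiplicities of the angles, which act as the weights
  of the rule, are never determined; the error term depends only on the number of nodes and on
  leading coefficients. Both sums are proportional to |X|, which cancels, so each rank is a quotient
  of Pochhammer symbols. The integrals defining the Jacobi polynomials are replaced by the moments
  of the Beta weight, so that orthogonality and norms become finite identities.\<close>

hide_const (open) Module.smult

section \<open>Rank of idempotent matrices\<close>

text \<open>A maximal independent set of columns spans the column space: it supplies
  \<open>B\<close>, and the coordinates of all columns supply \<open>C\<close>. That the columns of
  \<open>B\<close> are independent columns of \<open>A\<close> is recorded for the idempotent
  case.\<close>

lemma (in vec_space) rank_factorization: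
  assumes A: "A \<in> carrier_mat n nc"
  obtains B C where "B \<in> carrier_mat n (rank A)" "C \<in> carrier_mat (rank A) nc" "A = B * C"
    "set (cols B) \<subseteq> set (cols A)" "distinct (cols B)" "lin_indpt (set (cols B))"
proof -
  have colsA: "set (cols A) \<subseteq> carrier_vec n"
    using cols_dim A by blast
  obtain S where S: "finite S" "maximal S (\<lambda>T. T \<subseteq> set (cols A) \<and> lin_indpt T)"
    using maximal_exists_superset[of "set (cols A)" "\<lambda>T. T \<subseteq> set (cols A) \<and> lin_indpt T" "{}"]
    by (auto simp: finite_lin_indpt2)
  then have Ssub: "S \<subseteq> set (cols A)" and Sind: "lin_indpt S"
    by (auto simp: maximal_def)
  have S_carrier: "S \<subseteq> carrier_vec n"
    using Ssub colsA by blast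
  obtain bs where bs: "set bs = S" "distinct bs"
    using finite_distinct_list[OF S(1)] by blast
  have len: "length bs = rank A"
    using rank_card_indpt[OF A S(2)] bs distinct_card by fastforce
  define B where "B = mat_of_cols n bs"
  have B: "B \<in> carrier_mat n (rank A)"
    unfolding B_def using len by auto
  have colsB: "cols B = bs"
    unfolding B_def using S_carrier bs by (intro cols_mat_of_cols) auto
  have "\<exists>v\<in>carrier_vec (rank A). B *\<^sub>v v = col A j" if j: "j < nc" for j
  proof -
    have c: "col A j \<in> set (cols A)"
      using A j by (metis carrier_matD(2) cols_length cols_nth nth_mem)
    then have "lin_dep (insert (col A j) S)" if "col A j \<notin> S"
      using S(2) Ssub that unfolding maximal_def by blast
    then have "col A j \<in> span S"
      using lin_dep_iff_in_span[OF S_carrier Sind, of "col A j"] c colsA in_own_span[OF S_carrier]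
      by (cases "col A j \<in> S") auto
    from finite_in_span[OF S(1) S_carrier this] obtain a where "lincomb a S = col A j"
      by auto
    then have "col A j = B *\<^sub>v vec (rank A) (\<lambda>i. a (col B i))"
      using mat_mult_eq_lincomb[OF B, of a] bs colsB by simp
    then show ?thesis
      by (metis vec_carrier)
  qed
  then obtain v where v: "\<And>j. j < nc \<Longrightarrow> v j \<in> carrier_vec (rank A)"
    "\<And>j. j < nc \<Longrightarrow> B *\<^sub>v v j = col A j"
    by metis
  define C where "C = mat_of_cols (rank A) (map v [0..<nc])"
  have C: "C \<in> carrier_mat (rank A) nc"
    unfolding C_def by auto
  have "col C j = v j" if "j < nc" for j
    unfolding C_def using that v(1) by (subst col_mat_of_cols) auto
  then have "col A j = col (B * C) j" if "j < nc" for j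
    using col_mult2[OF B C that] v(2)[OF that] that by simp
  then have "A = B * C"
    using A B C by (intro mat_col_eqI) auto
  then show ?thesis
    using that[OF B C] colsB bs Ssub Sind by simp
qed

text \<open>In A = B C, idempotence gives B (C B) = B, and independence of the columns of
  \<open>B\<close> cancels \<open>B\<close> on the left, so C B = 1. The trace of B C equals that of
  C B, which is the inner dimension.\<close>

lemma (in vec_space) rank_idempotent:
  assumes A: "A \<in> carrier_mat n n" and idem: "A * A = A"
  shows "of_nat (rank A) = (\<Sum>i<n. A $$ (i, i))"
proof -
  define r where "r = rank A"
  obtain B C where B: "B \<in> carrier_mat n r" and C: "C \<in> carrier_mat r n" and ABC: "A = B * C"
    and colsB: "set (cols B) \<subseteq> set (cols A)" "distinct (cols B)" "lin_indpt (set (cols B))"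
    using rank_factorization[OF A] unfolding r_def by metis
  have "A * B = B"
  proof (rule mat_col_eqI)
    fix j assume "j < dim_col B"
    then have "col B j \<in> set (cols A)"
      using colsB(1) by (metis cols_length cols_nth nth_mem subsetD)
    then obtain k where "k < n" "col B j = col A k"
      using A by (metis carrier_matD(2) cols_length cols_nth in_set_conv_nth)
    then show "col (A * B) j = col B j"
      using col_mult2[OF A B, of j] col_mult2[OF A A, of k] B \<open>j < dim_col B\<close> by (simp add: idem)
  qed (use A B in auto)
  then have BCB: "B * (C * B) = B"
    using A B C by (simp add: ABC assoc_mult_mat[of B n r C n B r])
  have "C * B = 1\<^sub>m r"
  proof (rule mat_col_eqI)
    fix j assume "j < dim_col (1\<^sub>m r)"
    then have j: "j < r"
      by simp
    define w where "w = col (C * B) j - unit_vec r j"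
    have CB: "C * B \<in> carrier_mat r r"
      using B C by simp
    have w: "w \<in> carrier_vec r"
      unfolding w_def using CB j by simp
    have "B *\<^sub>v col (C * B) j = col B j"
      using col_mult2[OF B CB j] BCB by simp
    moreover have "B *\<^sub>v unit_vec r j = col B j"
      using col_mult2[OF B one_carrier_mat j] B j by simp
    ultimately have "B *\<^sub>v w = 0\<^sub>v n"
      unfolding w_def using B CB j by (simp add: mult_minus_distrib_mat_vec)
    then have "w = 0\<^sub>v r"
      using lin_depI[OF B w] colsB by blast
    then have "col (C * B) j = unit_vec r j"
      unfolding w_def using CB j
      by (auto simp: vec_eq_iff)
    then show "col (C * B) j = col (1\<^sub>m r) j"
      using j by simp
  qed (use B C in auto)
  then have tr: "(\<Sum>i<n. C $$ (k, i) * B $$ (i, k)) = 1" if "k < r" for k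
  proof -
    have "(C * B) $$ (k, k) = (\<Sum>i<n. C $$ (k, i) * B $$ (i, k))"
      using that B C by (auto simp: scalar_prod_def atLeast0LessThan)
    then show ?thesis
      using that by (simp add: \<open>C * B = 1\<^sub>m r\<close>)
  qed
  have "(\<Sum>i<n. A $$ (i, i)) = (\<Sum>i<n. \<Sum>k<r. B $$ (i, k) * C $$ (k, i))"
    unfolding ABC using B C by (intro sum.cong) (auto simp: scalar_prod_def atLeast0LessThan)
  also have "\<dots> = (\<Sum>k<r. \<Sum>i<n. C $$ (k, i) * B $$ (i, k))"
    by (subst sum.swap) (simp add: mult.commute)
  also have "\<dots> = of_nat r"
    using tr by simp
  finally show ?thesis
    by (simp add: r_def)
qed

section \<open>The Beta functional and shifted Jacobi polynomials\<close>

text \<open>An integral against a weight is represented by its moments \<mu>, so that orthogonality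
  can be treated algebraically.\<close>

definition moment_functional :: "(nat \<Rightarrow> 'a) \<Rightarrow> 'a poly \<Rightarrow> 'a::comm_ring_1" where
  "moment_functional \<mu> p = (\<Sum>k\<le>degree p. coeff p k * \<mu> k)"

text \<open>With any degree bound as upper limit, polynomials of different degrees share one range
  of summation, which is what additivity needs.\<close>

lemma moment_functional_altdef:
  "degree p \<le> n \<Longrightarrow> moment_functional \<mu> p = (\<Sum>k\<le>n. coeff p k * \<mu> k)"
  unfolding moment_functional_def
  by (rule sum.mono_neutral_left) (auto simp: coeff_eq_0)

lemma moment_functional_add:
  "moment_functional \<mu> (p + q) = moment_functional \<mu> p + moment_functional \<mu> q"
proof -
  let ?n = "max (degree p) (degree q)"
  have "degree (p + q) \<le> ?n"
    by (rule degree_add_le_max)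
  then show ?thesis
    by (simp add: moment_functional_altdef[of _ ?n] sum.distrib algebra_simps)
qed

lemma moment_functional_smult:
  "moment_functional \<mu> (smult c p) = c * moment_functional \<mu> p"
  using degree_smult_le[of c p]
  by (simp add: moment_functional_altdef[of _ "degree p"] sum_distrib_left mult.assoc)

lemma moment_functional_0 [simp]: "moment_functional \<mu> 0 = 0"
  by (simp add: moment_functional_def)

lemma moment_functional_diff:
  "moment_functional \<mu> (p - q) = moment_functional \<mu> p - moment_functional \<mu> q"
  using moment_functional_add[of \<mu> p "smult (- 1) q"]
  by (simp add: moment_functional_smult[of \<mu> "- 1" q, simplified])

lemma moment_functional_sum:
  "moment_functional \<mu> (sum f A) = (\<Sum>i\<in>A. moment_functional \<mu> (f i))"
  by (induction A rule: infinite_finite_induct) (auto simp: moment_functional_add)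

lemma moment_functional_monom [simp]: "moment_functional \<mu> (monom c n) = c * \<mu> n"
proof -
  have "(\<Sum>k\<le>n. (if n = k then c else 0) * \<mu> k) = c * \<mu> n"
    by (subst sum.remove[of _ n]) auto
  then show ?thesis
    by (simp add: moment_functional_altdef[OF degree_monom_le])
qed

text \<open>Moments of the Beta distribution with density proportional to
  \<open>\<xi>\<^sup>a\<^sup>-\<^sup>1 (1 - \<xi>)\<^sup>b\<^sup>-\<^sup>1\<close> on \<open>[0, 1]\<close>.\<close>

definition beta_mean :: "real \<Rightarrow> real \<Rightarrow> real poly \<Rightarrow> real" where
  "beta_mean a b = moment_functional (\<lambda>k. pochhammer a k / pochhammer (a + b) k)"

lemma beta_mean_linear:
  "beta_mean a b (p + q) = beta_mean a b p + beta_mean a b q"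
  "beta_mean a b (p - q) = beta_mean a b p - beta_mean a b q"
  "beta_mean a b (smult c p) = c * beta_mean a b p"
  "beta_mean a b (sum f A) = (\<Sum>i\<in>A. beta_mean a b (f i))"
  by (simp_all only: beta_mean_def moment_functional_add moment_functional_diff
    moment_functional_smult moment_functional_sum)

lemma beta_mean_monom [simp]:
  "beta_mean a b (monom c k) = c * (pochhammer a k / pochhammer (a + b) k)"
  by (simp add: beta_mean_def)

lemma beta_mean_1 [simp]: "beta_mean a b 1 = 1"
  using beta_mean_monom[of a b 1 0] by (simp add: one_poly_eq_simps)

lemma monomial_expansion: "p = (\<Sum>k\<le>degree p. smult (coeff p k) (monom 1 k))" for p :: "'a::comm_semiring_1 poly"
  using poly_as_sum_of_monoms[of p] by (simp add: smult_monom)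

section \<open>Orthogonal polynomials of the Beta weight\<close>

context
  fixes a b :: real
  assumes a: "a > 0" and b: "b > 0"
begin

lemma pochhammer_nz [simp]:
  "pochhammer a k \<noteq> 0" "pochhammer b k \<noteq> 0" "pochhammer (a + b) k \<noteq> 0"
  using pochhammer_pos[OF a, of k] pochhammer_pos[OF b, of k] pochhammer_pos[of "a + b" k] a b
  by auto

text \<open>This is the ratio of Beta(a + k, b + j) to Beta(a, b). Each factor 1 - \<xi> is removed
  by (1 - \<xi>) \<xi>^k = \<xi>^k - \<xi>^(k+1), hence the arbitrary \<open>k\<close> in the
  induction.\<close>

lemma beta_mean_mixed:
  "beta_mean a b ([:1, - 1:] ^ j * monom 1 k) =
     pochhammer b j * pochhammer a k / pochhammer (a + b) (j + k)"
proof (induction j arbitrary: k)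
  case (Suc j)
  have "[:1, - 1:] * monom 1 k = monom 1 k - monom (1::real) (Suc k)"
    by (intro poly_eqI) (simp add: coeff_pCons split: nat.splits)
  then have "[:1, - 1:] ^ Suc j * monom 1 k =
      [:1, - 1:] ^ j * monom 1 k - [:1, - 1:] ^ j * monom (1::real) (Suc k)"
    by (simp only: power_Suc2 mult.assoc right_diff_distrib)
  then have "beta_mean a b ([:1, - 1:] ^ Suc j * monom 1 k) =
      pochhammer b j * pochhammer a k / pochhammer (a + b) (j + k)
      - pochhammer b j * pochhammer a (Suc k) / pochhammer (a + b) (j + Suc k)"
    by (simp only: beta_mean_linear Suc.IH)
  moreover have "a + b + real (j + k) \<noteq> 0"
    using a b by (smt (verit) of_nat_0_le_iff)
  ultimately show ?case
    by (simp add: pochhammer_Suc divide_simps) (simp add: algebra_simps)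
qed simp

text \<open>Integration by parts: the left-hand side is the mean of
  \<open>w\<^sup>-\<^sup>1 d/d\<xi> (\<xi> (1 - \<xi>) w f)\<close>, with \<open>w\<close> the Beta density.\<close>

lemma beta_mean_by_parts:
  "beta_mean a b ([:0, 1, - 1:] * pderiv f + [:a, - (a + b):] * f) = 0"
proof -
  \<comment> \<open>On a monomial the identity is the recurrence (a + b + k) \<mu>_(k+1) = (a + k)
    \<mu>_k of the Beta moments.\<close>
  have *: "beta_mean a b ([:0, 1, - 1:] * pderiv (monom 1 k) + [:a, - (a + b):] * monom 1 k) = 0" for k
  proof -
    have "[:0, 1, - 1:] * pderiv (monom 1 k) + [:a, - (a + b):] * monom 1 k
        = monom (a + real k) k - monom (a + b + real k) (Suc k)"
      by (intro poly_eqI) (auto simp: coeff_pCons coeff_pderiv split: nat.splits)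
    moreover have "a + b + real k \<noteq> 0"
      using a b by (smt (verit) of_nat_0_le_iff)
    then have "(a + real k) * (x / y) = (a + b + real k) * (x * (a + real k) / (y * (a + b + real k)))"
      for x y :: real
      by simp
    ultimately show ?thesis
      by (simp only: beta_mean_linear beta_mean_monom pochhammer_Suc)
  qed
  have "[:0, 1, - 1:] * pderiv f + [:a, - (a + b):] * f = (\<Sum>k\<le>degree f. smult (coeff f k)
      ([:0, 1, - 1:] * pderiv (monom 1 k) + [:a, - (a + b):] * monom 1 k))"
  proof -
    have "u * pderiv (\<Sum>k\<in>A. smult (c k) (p k)) + v * (\<Sum>k\<in>A. smult (c k) (p k)) =
        (\<Sum>k\<in>A. smult (c k) (u * pderiv (p k) + v * p k))"
      for A c and p :: "nat \<Rightarrow> real poly" and u v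
      by (induction A rule: infinite_finite_induct)
        (auto simp: pderiv_add pderiv_smult smult_add_right algebra_simps)
    from this[where A = "{..degree f}" and c = "coeff f" and p = "monom 1"] show ?thesis
      using monomial_expansion[of f] by metis
  qed
  then show ?thesis
    using * by (simp add: beta_mean_linear del: mult_pCons_left)
qed

text \<open>This is (b)_i / i! times 2F1(-i, i + a + b - 1; b; 1 - \<xi>), the Jacobi polynomial
  with \<alpha> = b - 1 and \<beta> = a - 1 at 2\<xi> - 1. Expanding at 1 makes the normalization
  visible and fits \<open>beta_mean_mixed\<close>.\<close>

definition shifted_jacobi :: "nat \<Rightarrow> real poly" where
  "shifted_jacobi i = smult (pochhammer b i / fact i)
     (\<Sum>j\<le>i. smult (pochhammer (- real i) j * pochhammer (real i + a + b - 1) j / (fact j * pochhammer b j))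
       ([:1, - 1:] ^ j))"

lemma poly_shifted_jacobi_1: "poly (shifted_jacobi i) 1 = pochhammer b i / fact i"
proof -
  have "(\<Sum>j\<le>i. pochhammer (- real i) j * pochhammer (real i + a + b - 1) j / (fact j * pochhammer b j) * 0 ^ j) = 1"
    by (subst sum.remove[of _ 0]) auto
  then show ?thesis
    by (simp add: shifted_jacobi_def poly_sum)
qed

lemma degree_power_one_minus: "degree ([:1, - 1:] ^ j :: real poly) = j"
  by (simp add: degree_power_eq)

lemma coeff_power_one_minus: "coeff ([:1, - 1:] ^ j :: real poly) j = (- 1) ^ j"
  using lead_coeff_power[of "[:1, - 1:] :: real poly" j] by (simp add: degree_power_one_minus)

lemma degree_shifted_jacobi_le: "degree (shifted_jacobi i) \<le> i"
  unfolding shifted_jacobi_def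
  by (rule order.trans[OF degree_smult_le], rule degree_sum_le)
    (auto intro: order.trans[OF degree_smult_le] simp: degree_power_one_minus)

lemma coeff_shifted_jacobi: "coeff (shifted_jacobi i) i = pochhammer (real i + a + b - 1) i / fact i"
proof -
  let ?c = "\<lambda>j. pochhammer (- real i) j * pochhammer (real i + a + b - 1) j / (fact j * pochhammer b j)"
  have "(\<Sum>j\<le>i. ?c j * coeff ([:1, - 1:] ^ j :: real poly) i) = ?c i * (- 1) ^ i"
  proof (subst sum.remove[of _ i])
    have "(\<Sum>j\<in>{..i} - {i}. ?c j * coeff ([:1, - 1:] ^ j :: real poly) i) = 0"
      by (intro sum.neutral) (auto simp: coeff_eq_0 degree_power_one_minus)
    then show "?c i * coeff ([:1, - 1:] ^ i :: real poly) i
        + (\<Sum>j\<in>{..i} - {i}. ?c j * coeff ([:1, - 1:] ^ j :: real poly) i) = ?c i * (- 1) ^ i"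
      by (simp add: coeff_power_one_minus)
  qed auto
  moreover have "pochhammer (- real i) i = (- 1) ^ i * fact i"
    by (rule pochhammer_same)
  moreover have "(- 1) ^ i * (- 1) ^ i = (1::real)"
    by (simp flip: power_mult_distrib)
  ultimately show ?thesis
    by (simp add: shifted_jacobi_def coeff_sum field_simps)
qed

text \<open>The case i = 0 is separate because a + b - 1 may be negative; the empty Pochhammer
  symbol is still 1.\<close>

lemma coeff_shifted_jacobi_pos: "coeff (shifted_jacobi i) i > 0"
proof (cases i)
  case 0
  then show ?thesis
    by (simp add: coeff_shifted_jacobi)
next
  case (Suc k)
  then have "real i + a + b - 1 > 0"
    using a b by simp
  then show ?thesis
    by (simp add: coeff_shifted_jacobi pochhammer_pos)
qed

lemma degree_shifted_jacobi: "degree (shifted_jacobi i) = i"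
  using coeff_shifted_jacobi_pos[of i] degree_shifted_jacobi_le[of i]
  by (metis le_degree less_irrefl order_antisym)

text \<open>The factor (b)_j cancels against the mean of (1 - \<xi>)^j \<xi>^k, leaving a
  terminating 2F1 at 1, summed by Chu-Vandermonde. Orthogonality is the vanishing of (k + 1 - i)_i
  for k < i.\<close>

lemma beta_mean_shifted_jacobi_monom:
  "beta_mean a b (shifted_jacobi i * monom 1 k) =
     pochhammer b i * pochhammer a k * pochhammer (real k + 1 - real i) i / (fact i * pochhammer (a + b) (k + i))"
proof -
  let ?N = "a + b"
  have prod: "pochhammer ?N (k + j) = pochhammer ?N k * pochhammer (?N + real k) j" for j
    by (rule pochhammer_product')
  have "beta_mean a b (shifted_jacobi i * monom 1 k) =
      pochhammer b i / fact i * (\<Sum>j\<le>i. pochhammer (- real i) j * pochhammer (real i + a + b - 1) j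
        / (fact j * pochhammer b j) * (pochhammer b j * pochhammer a k / pochhammer ?N (j + k)))"
    unfolding shifted_jacobi_def mult_smult_left sum_distrib_right beta_mean_linear beta_mean_mixed ..
  also have "\<dots> = pochhammer b i / fact i * (pochhammer a k / pochhammer ?N k *
      (\<Sum>j=0..i. (pochhammer (real i + a + b - 1) j * pochhammer (- real i) j) /
        (fact j * pochhammer (?N + real k) j)))"
  proof -
    have "x * y / (f * B) * (B * A / (u * v)) = A / u * (y * x / (f * v))" if "B \<noteq> 0"
      for x y f A B u v :: real
      using that by (simp add: mult_ac)
    note cancel = this[OF pochhammer_nz(2)]
    show ?thesis
      unfolding sum_distrib_left atMost_atLeast0 add.commute[of _ k] prod cancel ..
  qed
  also have "(\<Sum>j=0..i. (pochhammer (real i + a + b - 1) j * pochhammer (- real i) j) /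
        (fact j * pochhammer (?N + real k) j)) =
      pochhammer (?N + real k - (real i + a + b - 1)) i / pochhammer (?N + real k) i"
  proof -
    have "\<forall>l\<in>{0..<i}. ?N + real k \<noteq> - real l"
      using a b by (auto simp: add_eq_0_iff2 dest: sym)
    from Vandermonde_pochhammer[OF this, of "real i + a + b - 1"] show ?thesis
      by simp
  qed
  finally show ?thesis
    unfolding prod by (simp add: algebra_simps)
qed

text \<open>The mean of \<open>shifted_jacobi i\<close> against \<xi>^i; times the leading
  coefficient it is the squared norm.\<close>

definition jacobi_moment :: "nat \<Rightarrow> real" where
  "jacobi_moment i = pochhammer b i * pochhammer a i / pochhammer (a + b) (2 * i)"

lemma jacobi_moment_nz [simp]: "jacobi_moment i \<noteq> 0"
  by (simp add: jacobi_moment_def)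

text \<open>Allowing degree \<open>i\<close> covers two uses: orthogonality, where the coefficient
  is 0, and the norm, where it is the leading coefficient.\<close>

lemma beta_mean_shifted_jacobi:
  assumes "degree q \<le> i"
  shows "beta_mean a b (shifted_jacobi i * q) = coeff q i * jacobi_moment i"
proof -
  have lower: "beta_mean a b (shifted_jacobi i * monom 1 k) = 0" if "k < i" for k
  proof -
    have "real k + 1 - real i = - real (i - Suc k)"
      using that by simp
    then have "pochhammer (real k + 1 - real i) i = 0"
      using that unfolding pochhammer_eq_0_iff by (intro exI[of _ "i - Suc k"]) auto
    then show ?thesis
      by (simp add: beta_mean_shifted_jacobi_monom)
  qed
  have top: "beta_mean a b (shifted_jacobi i * monom 1 i) = jacobi_moment i"
    by (simp add: beta_mean_shifted_jacobi_monom jacobi_moment_def mult_2 pochhammer_fact[symmetric])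
  have "q = (\<Sum>k\<le>i. smult (coeff q k) (monom 1 k))"
    using poly_as_sum_of_monoms'[OF assms] by (simp add: smult_monom)
  then have "beta_mean a b (shifted_jacobi i * q) =
      beta_mean a b (shifted_jacobi i * (\<Sum>k\<le>i. smult (coeff q k) (monom 1 k)))"
    by simp
  also have "\<dots> = (\<Sum>k\<le>i. coeff q k * beta_mean a b (shifted_jacobi i * monom 1 k))"
    by (simp add: sum_distrib_left beta_mean_linear)
  also have "\<dots> = coeff q i * jacobi_moment i"
    by (subst sum.remove[of _ i]) (auto simp: lower top)
  finally show ?thesis .
qed

text \<open>Subtracting the multiple of \<open>shifted_jacobi i\<close> with the same top
  coefficient leaves \<open>d\<close>. If nonzero, it has a degree j < i and is orthogonal to
  \<open>shifted_jacobi j\<close>, yet that mean is its leading coefficient times a nonzero moment.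
  The value at 1 then fixes the multiple.\<close>

lemma shifted_jacobi_unique:
  assumes deg: "degree p = i" and orth: "\<And>q. degree q < i \<Longrightarrow> beta_mean a b (p * q) = 0"
    and one: "poly p 1 = pochhammer b i / fact i"
  shows "p = shifted_jacobi i"
proof -
  define c where "c = coeff p i / coeff (shifted_jacobi i) i"
  define d where "d = p - smult c (shifted_jacobi i)"
  have di: "coeff d i = 0"
    using coeff_shifted_jacobi_pos[of i] by (simp add: d_def c_def)
  have "d = 0"
  proof (rule ccontr)
    assume "d \<noteq> 0"
    define j where "j = degree d"
    have "j \<le> i"
      unfolding j_def d_def using deg degree_shifted_jacobi[of i]
      by (intro degree_diff_le) (auto intro: order.trans[OF degree_smult_le])
    moreover have dj: "coeff d j \<noteq> 0"
      using \<open>d \<noteq> 0\<close> by (simp add: j_def)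
    ultimately have "j < i"
      using di by (metis le_neq_implies_less)
    then have "beta_mean a b (d * shifted_jacobi j) = 0"
      unfolding d_def left_diff_distrib mult_smult_left beta_mean_linear
      by (simp add: orth degree_shifted_jacobi beta_mean_shifted_jacobi coeff_eq_0)
    then show False
      using beta_mean_shifted_jacobi[of d j] dj by (simp add: j_def mult.commute)
  qed
  then have p: "p = smult c (shifted_jacobi i)"
    by (simp add: d_def)
  then have "c = 1"
    using one by (simp add: poly_shifted_jacobi_1)
  then show ?thesis
    using p by simp
qed

end

section \<open>Identification of the zonal polynomials\<close>

lemma has_integral_beta_mean:
  assumes a: "a > 0" and b: "b > 0"
  shows "((\<lambda>x. poly f x * (x powr (a - 1) * (1 - x) powr (b - 1))) has_integral
    Beta a b * beta_mean a b f) {0..1}"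
proof -
  have "((\<lambda>x. x ^ k * (x powr (a - 1) * (1 - x) powr (b - 1))) has_integral
      Beta a b * (pochhammer a k / pochhammer (a + b) k)) {0..1}" for k
  proof -
    have nonpos: "x \<notin> \<int>\<^sub>\<le>\<^sub>0" if "x > 0" for x :: real
      using that by (auto elim!: nonpos_Ints_cases)
    have "Beta (a + real k) b = Beta a b * (pochhammer a k / pochhammer (a + b) k)"
      using a b Gamma_real_pos[OF a] Gamma_real_pos[of "a + b"]
      by (simp add: Beta_def pochhammer_Gamma nonpos add_ac less_imp_neq[symmetric])
    moreover have "x powr (a + real k - 1) * (1 - x) powr (b - 1) =
        x ^ k * (x powr (a - 1) * (1 - x) powr (b - 1))" if "x \<in> {0..1}" for x
    \<comment> \<open>\<open>powr\<close> with base 0 is 0, so both sides vanish at this endpoint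
      whatever the exponent.\<close>
    proof (cases "x = 0")
      case False
      with that have "x > 0"
        by simp
      then show ?thesis
        using powr_add[of x "a - 1" "real k"] by (simp add: powr_realpow algebra_simps)
    qed simp
    ultimately show ?thesis
      using has_integral_Beta_real[of "a + real k" b] a b
      by (metis (no_types, lifting) has_integral_eq add_pos_nonneg of_nat_0_le_iff)
  qed
  then have "((\<lambda>x. \<Sum>k\<le>degree f. coeff f k * (x ^ k * (x powr (a - 1) * (1 - x) powr (b - 1)))) has_integral
      (\<Sum>k\<le>degree f. coeff f k * (Beta a b * (pochhammer a k / pochhammer (a + b) k)))) {0..1}"
    by (intro has_integral_sum has_integral_mult_right) auto
  then show ?thesis
    by (simp add: poly_altdef sum_distrib_right sum_distrib_left beta_mean_def moment_functional_def
      mult_ac)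
qed

lemma has_integral_jacobi_weight:
  assumes a: "a > 0" and b: "b > 0"
  shows "((\<lambda>\<tau>. poly f \<tau> * ((1 - \<tau>) powr (b - 1) * (1 + \<tau>) powr (a - 1))) has_integral
    2 powr (a + b - 1) * Beta a b * beta_mean a b (f \<circ>\<^sub>p [:- 1, 2:])) {-1..1}"
proof -
  let ?w = "\<lambda>x. poly (f \<circ>\<^sub>p [:- 1, 2:]) x * (x powr (a - 1) * (1 - x) powr (b - 1))"
  have "(?w has_integral Beta a b * beta_mean a b (f \<circ>\<^sub>p [:- 1, 2:])) (cbox 0 1)"
    using has_integral_beta_mean[OF a b, of "f \<circ>\<^sub>p [:- 1, 2:]"] by simp
  from has_integral_affinity'[OF this, of "1 / 2" "1 / 2"]
  have "((\<lambda>\<tau>. ?w (\<tau> / 2 + 1 / 2)) has_integral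
      2 * (Beta a b * beta_mean a b (f \<circ>\<^sub>p [:- 1, 2:]))) {-1..1}"
    by (simp add: mult_ac)
  \<comment> \<open>Halving 1 + \<tau> and 1 - \<tau> costs 2^(a + b - 2), restored here; the
    remaining factor 2 of the constant is the Jacobian.\<close>
  from has_integral_mult_right[OF this, of "2 powr (a - 1) * 2 powr (b - 1)"]
  have "((\<lambda>\<tau>. 2 powr (a - 1) * 2 powr (b - 1) * ?w (\<tau> / 2 + 1 / 2)) has_integral
      2 powr (a + b - 1) * Beta a b * beta_mean a b (f \<circ>\<^sub>p [:- 1, 2:])) {-1..1}"
    by (simp add: powr_add powr_diff mult_ac)
  moreover have "2 powr (a - 1) * 2 powr (b - 1) * ?w (\<tau> / 2 + 1 / 2) =
      poly f \<tau> * ((1 - \<tau>) powr (b - 1) * (1 + \<tau>) powr (a - 1))" if "\<tau> \<in> {-1..1}" for \<tau>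
  proof -
    have "\<tau> / 2 + 1 / 2 = (1 + \<tau>) / 2" "1 - (\<tau> / 2 + 1 / 2) = (1 - \<tau>) / 2"
      by (simp_all add: field_simps)
    then show ?thesis
      using that by (simp only: powr_divide) (simp add: poly_pcompose powr_divide field_simps)
  qed
  ultimately show ?thesis
    by (metis (no_types, lifting) has_integral_eq)
qed

text \<open>The definite description in \<open>jacobi\<close> is resolved by existence and
  uniqueness on [0, 1]: the substitution changes integrals only by a positive constant, so
  orthogonality is preserved. The parameters cross over, as \<open>b\<close> belongs to 1 -
  \<tau>.\<close>

lemma jacobi_eq_shifted_jacobi:
  assumes a: "a > 0" and b: "b > 0"
  shows "jacobi (b - 1) (a - 1) i = shifted_jacobi a b i \<circ>\<^sub>p [:1 / 2, 1 / 2:]"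
proof -
  let ?up = "\<lambda>p. p \<circ>\<^sub>p [:- 1, 2 :: real:]" and ?down = "\<lambda>p. p \<circ>\<^sub>p [:1 / 2, 1 / 2 :: real:]"
  have up_down: "?up (?down p) = p" and down_up: "?down (?up p) = p" for p
    by (simp_all flip: pcompose_assoc add: pcompose_pCons)
  have "Beta a b > 0"
    using Gamma_real_pos[OF a] Gamma_real_pos[OF b] Gamma_real_pos[of "a + b"] a b
    by (simp add: Beta_def)
  have orth: "integral {-1..1} (\<lambda>\<tau>. poly p \<tau> * poly q \<tau> * ((1 - \<tau>) powr (b - 1) * (1 + \<tau>) powr (a - 1))) = 0
      \<longleftrightarrow> beta_mean a b (?up p * ?up q) = 0" for p q
  proof -
    have "integral {-1..1} (\<lambda>\<tau>. poly p \<tau> * poly q \<tau> * ((1 - \<tau>) powr (b - 1) * (1 + \<tau>) powr (a - 1))) =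
        2 powr (a + b - 1) * Beta a b * beta_mean a b (?up p * ?up q)"
      using has_integral_jacobi_weight[OF a b, of "p * q"]
      by (intro integral_unique) (simp add: pcompose_mult)
    then show ?thesis
      using \<open>Beta a b > 0\<close> by simp
  qed
  show ?thesis
    unfolding jacobi_def orth
  proof (rule the_equality)
    show "degree (?down (shifted_jacobi a b i)) = i \<and>
      (\<forall>q. degree q < i \<longrightarrow> beta_mean a b (?up (?down (shifted_jacobi a b i)) * ?up q) = 0) \<and>
      poly (?down (shifted_jacobi a b i)) 1 = pochhammer (b - 1 + 1) i / fact i"
      unfolding up_down
    proof (intro conjI allI impI)
      fix q :: "real poly" assume "degree q < i"
      then have "degree (?up q) < i"
        by (simp add: degree_pcompose)
      then show "beta_mean a b (shifted_jacobi a b i * ?up q) = 0"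
        by (simp add: beta_mean_shifted_jacobi[OF a b] coeff_eq_0)
    qed (simp_all add: degree_pcompose degree_shifted_jacobi[OF a b] poly_pcompose
        poly_shifted_jacobi_1[OF a b])
  next
    fix p
    assume p: "degree p = i \<and> (\<forall>q. degree q < i \<longrightarrow> beta_mean a b (?up p * ?up q) = 0) \<and>
      poly p 1 = pochhammer (b - 1 + 1) i / fact i"
    have "?up p = shifted_jacobi a b i"
    proof (rule shifted_jacobi_unique[OF a b])
      fix q :: "real poly" assume "degree q < i"
      then have "degree (?down q) < i"
        by (simp add: degree_pcompose)
      then show "beta_mean a b (?up p * q) = 0"
        using p up_down[of q] by metis
    qed (use p in \<open>auto simp: poly_pcompose degree_pcompose\<close>)
    then show "p = ?down (shifted_jacobi a b i)"
      using down_up by metis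
  qed
qed

lemma zonal_eq_shifted_jacobi:
  assumes "half_dim F > 0" and "n \<ge> 1"
  shows "zonal F n i \<xi> = poly (shifted_jacobi (half_dim F) (half_dim F * real n) i) \<xi>"
proof -
  have "half_dim F * (real n + 1) - half_dim F = half_dim F * real n"
    by (simp add: algebra_simps)
  then show ?thesis
    using assms jacobi_eq_shifted_jacobi[of "half_dim F" "half_dim F * real n" i]
    by (simp add: zonal_def Let_def poly_pcompose field_simps)
qed

section \<open>The Gauss--Lobatto error term\<close>

lemma beta_mean_shifted_jacobi_square:
  assumes a: "a > 0" and b: "b > 0"
  shows "beta_mean a b ((shifted_jacobi a b i)\<^sup>2) = coeff (shifted_jacobi a b i) i * jacobi_moment a b i"
  using beta_mean_shifted_jacobi[OF a b, of "shifted_jacobi a b i" i]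
  by (simp add: degree_shifted_jacobi[OF a b] power2_eq_square)

text \<open>A sum that reproduces the mean up to degree \<open>2 s - 1\<close> and has nodes \<open>0\<close>, \<open>1\<close> and \<open>s - 1\<close>
  others is a Gauss--Lobatto rule. Its error in degree \<open>2 s\<close> is read off from
  \<open>W = \<xi> (1 - \<xi>) G P\<^sub>s'\<close>, where \<open>G\<close> is the monic polynomial with the other nodes as zeros. Adding \<open>(k / s) W\<close> to \<open>P\<^sub>s\<^sup>2\<close>, where \<open>k\<close> is
  the leading coefficient of \<open>P\<^sub>s\<close>, cancels the leading term, and the mean of \<open>W\<close> follows by
  integration by parts.\<close>

lemma lobatto_sum_shifted_jacobi_square:
  assumes a: "a > 0" and b: "b > 0" and s: "s \<ge> 1"
    and Y: "finite Y" "y \<in> Y" "c y = 1" "\<And>x. x \<in> Y \<Longrightarrow> x \<noteq> y \<Longrightarrow> c x \<in> A"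
    and A: "finite A" "card A = s" "0 \<in> A"
    and exact: "\<And>f. degree f \<le> 2 * s - 1 \<Longrightarrow> (\<Sum>x\<in>Y. poly f (c x)) = v * beta_mean a b f"
  shows "(\<Sum>x\<in>Y. (poly (shifted_jacobi a b s) (c x))\<^sup>2) =
    v * coeff (shifted_jacobi a b s) s * jacobi_moment a b s * ((2 * real s + a + b - 1) / real s)"
proof -
  define p where "p = shifted_jacobi a b s"
  define k where "k = coeff p s"
  define H where "H = jacobi_moment a b s"
  define G where "G = (\<Prod>z\<in>A - {0}. [:- z, 1:])"
  define W where "W = [:0, 1, - 1:] * pderiv p * G"
  have deg_p: "degree p = s"
    unfolding p_def by (rule degree_shifted_jacobi[OF a b])
  have deg_G: "degree G = s - 1"
    unfolding G_def using A by (subst degree_prod_eq_sum_degree) auto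
  have lead_G: "coeff G (s - 1) = 1"
  proof -
    have "lead_coeff G = 1"
      unfolding G_def by (simp add: lead_coeff_prod)
    then show ?thesis
      by (simp add: deg_G)
  qed
  have W_node: "poly W (c x) = 0" if "x \<in> Y" for x
  proof (cases "x = y \<or> c x = 0")
    case True
    then show ?thesis
      using Y by (auto simp: W_def)
  next
    case False
    then have "poly G (c x) = 0"
      unfolding G_def poly_prod using A Y that by (intro prod_zero) auto
    then show ?thesis
      by (simp add: W_def)
  qed
  have deg_p': "degree (pderiv p) = s - 1"
    by (simp add: degree_pderiv deg_p)
  have deg_W: "degree W \<le> 2 * s" and coeff_W: "coeff W (2 * s) = - real s * k"
  proof -
    have u: "degree [:0, 1, - 1 :: real:] = 2" "coeff [:0, 1, - 1 :: real:] 2 = - 1"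
      by (simp_all add: numeral_2_eq_2)
    have le: "degree ([:0, 1, - 1:] * pderiv p) \<le> s + 1"
      using degree_mult_le[of "[:0, 1, - 1:]" "pderiv p"] s unfolding u deg_p' by simp
    have "coeff ([:0, 1, - 1:] * pderiv p) (s + 1) = - real s * k"
      using coeff_mult_degree_sum[of "[:0, 1, - 1:]" "pderiv p"] s unfolding u deg_p'
      by (simp add: coeff_pderiv k_def)
    moreover have "degree ([:0, 1, - 1:] * pderiv p) = s + 1 \<or> pderiv p = 0"
      using degree_mult_eq[of "[:0, 1, - 1:]" "pderiv p"] s u deg_p' by fastforce
    ultimately show "coeff W (2 * s) = - real s * k"
      unfolding W_def using coeff_mult_degree_sum[of "[:0, 1, - 1:] * pderiv p" G] s lead_G
      by (auto simp: deg_G mult_2)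
    show "degree W \<le> 2 * s"
      using degree_mult_le[of "[:0, 1, - 1:] * pderiv p" G] le s unfolding W_def deg_G by simp
  qed
  have mean_W: "beta_mean a b W = (real s + a + b - 1) * H"
  proof -
    \<comment> \<open>The product rule splits the integrated derivative of \<xi> (1 - \<xi>) p G as
      W + p B. Since \<open>B\<close> has degree at most s, only its coefficient at \<xi>^s survives
      against \<open>p\<close>.\<close>
    define B where "B = [:0, 1, - 1:] * pderiv G + [:a, - (a + b):] * G"
    have "[:0, 1, - 1:] * pderiv (p * G) + [:a, - (a + b):] * (p * G) = W + p * B"
      unfolding W_def B_def pderiv_mult by (simp only: algebra_simps)
    then have "beta_mean a b W = - beta_mean a b (p * B)"
      using beta_mean_by_parts[OF a b, of "p * G"] beta_mean_linear(1)[of a b W "p * B"] by simp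
    also have "degree B \<le> s"
    proof -
      have "degree ([:0, 1, - 1:] * pderiv G) \<le> s"
      proof (cases "s = 1")
        case True
        then have "pderiv G = 0"
          using deg_G by (simp add: pderiv_eq_0_iff)
        then show ?thesis
          by simp
      next
        case False
        then show ?thesis
          using degree_mult_le[of "[:0, 1, - 1:]" "pderiv G"] s by (simp add: degree_pderiv deg_G)
      qed
      moreover have "degree ([:a, - (a + b):] * G) \<le> s"
        using degree_mult_le[of "[:a, - (a + b):]" G] s by (simp add: deg_G split: if_splits)
      ultimately show ?thesis
        unfolding B_def by (rule degree_add_le)
    qed
    then have "beta_mean a b (p * B) = coeff B s * H"
      unfolding p_def H_def by (rule beta_mean_shifted_jacobi[OF a b])
    \<comment> \<open>-(s - 1) comes from \<xi> (1 - \<xi>) G' and -(a + b) from the linear factor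
      times \<open>G\<close>, which is monic of degree s - 1.\<close>
    also have "coeff B s = - (real s - 1) - (a + b)"
    proof -
      obtain r where r: "s = Suc r"
        using s by (cases s) auto
      have "coeff G (Suc r) = 0" "coeff G (Suc (Suc r)) = 0" "coeff G r = 1"
        using deg_G lead_G by (auto simp: r coeff_eq_0)
      then show ?thesis
        unfolding B_def r by (cases r) (auto simp: coeff_pCons coeff_pderiv split: nat.splits)
    qed
    finally show ?thesis
      by (simp add: algebra_simps)
  qed
  define Q where "Q = p\<^sup>2 + smult (k / real s) W"
  have "coeff (p\<^sup>2) (2 * s) = k\<^sup>2"
    using coeff_mult_degree_sum[of p p] by (simp add: deg_p k_def power2_eq_square mult_2)
  then have "coeff Q (2 * s) = 0"
    using s by (simp add: Q_def coeff_W power2_eq_square)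
  moreover have "degree Q \<le> 2 * s"
    unfolding Q_def using degree_mult_le[of p p] deg_W
    by (intro degree_add_le) (auto simp: deg_p power2_eq_square intro: order.trans[OF degree_smult_le])
  ultimately have "degree Q \<le> 2 * s - 1"
    using s by (metis Suc_diff_1 Suc_le_eq coeff_0_degree_minus_1 le_neq_implies_less leading_coeff_0_iff
      degree_0 less_Suc_eq_le mult_pos_pos pos2 zero_less_one less_le_trans)
  then have "(\<Sum>x\<in>Y. poly Q (c x)) = v * beta_mean a b Q"
    by (rule exact)
  moreover have "(\<Sum>x\<in>Y. poly Q (c x)) = (\<Sum>x\<in>Y. (poly p (c x))\<^sup>2)"
    by (intro sum.cong) (simp_all add: Q_def W_node)
  \<comment> \<open>The two terms combine to k H (1 + (s + a + b - 1)/s), which gives the last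
    factor of the claim.\<close>
  moreover have "beta_mean a b Q = k * H + k / real s * ((real s + a + b - 1) * H)"
    unfolding Q_def beta_mean_linear mean_W
    unfolding p_def k_def H_def beta_mean_shifted_jacobi_square[OF a b] ..
  ultimately show ?thesis
    using s unfolding p_def[symmetric] k_def[symmetric] H_def[symmetric] by (simp add: field_simps)
qed

section \<open>Tight designs\<close>

text \<open>P_0, ..., P_t span all degrees up to t. For i \<ge> 1 the sum of P_i vanishes by the
  design property and its mean by orthogonality to 1; the constants supply the factor |X|.\<close>

lemma design_sum:
  assumes hd: "half_dim F > 0" and n: "n \<ge> 1" and X: "design F n t X" "y \<in> X" and f: "degree f \<le> t"
  shows "(\<Sum>x\<in>X. poly f (proj_prod x y)) = real (card X) * beta_mean (half_dim F) (half_dim F * real n) f"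
proof -
  let ?a = "half_dim F" and ?b = "half_dim F * real n"
  let ?P = "shifted_jacobi ?a ?b"
  have b: "?b > 0"
    using hd n by simp
  have "(\<Sum>x\<in>X. poly f (proj_prod x y)) = real (card X) * beta_mean ?a ?b f"
    if "degree f \<le> d" "d \<le> t" for d
    using that
  proof (induction d arbitrary: f)
    case 0
    then have "degree f = 0"
      by simp
    then obtain c where "f = [:c:]"
      by (rule degree_eq_zeroE)
    moreover have "beta_mean ?a ?b [:c:] = c"
      using beta_mean_linear(3)[of ?a ?b c 1] by simp
    ultimately show ?case
      by simp
  next
    case (Suc d)
    define P where "P = ?P (Suc d)"
    have P: "degree P = Suc d" "coeff P (Suc d) > 0"
      unfolding P_def using degree_shifted_jacobi[OF hd b] coeff_shifted_jacobi_pos[OF hd b] by auto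
    define c where "c = coeff f (Suc d) / coeff P (Suc d)"
    define g where "g = f - smult c P"
    have "degree g \<le> Suc d"
      unfolding g_def using Suc.prems P by (intro degree_diff_le) (auto intro: order.trans[OF degree_smult_le])
    moreover have "coeff g (Suc d) = 0"
      using P by (simp add: g_def c_def)
    ultimately have "degree g \<le> d"
      by (metis degree_0 le_Suc_eq le0 leading_coeff_0_iff)
    then have IH: "(\<Sum>x\<in>X. poly g (proj_prod x y)) = real (card X) * beta_mean ?a ?b g"
      using Suc by simp
    have "(\<Sum>x\<in>X. zonal F n (Suc d) (proj_prod x y)) = 0"
      using X Suc.prems(2) by (simp add: design_def)
    then have "(\<Sum>x\<in>X. poly P (proj_prod x y)) = 0"
      by (simp add: zonal_eq_shifted_jacobi[OF hd n] P_def)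
    moreover have "beta_mean ?a ?b P = 0"
      using beta_mean_shifted_jacobi[OF hd b, of 1 "Suc d"] by (simp add: P_def)
    moreover have "f = g + smult c P"
      by (simp add: g_def)
    ultimately show ?case
      using IH by (simp add: beta_mean_linear sum.distrib flip: sum_distrib_left)
  qed
  then show ?thesis
    using f by blast
qed

section \<open>Zonal matrices on projective points\<close>

lemma proj_space_memE:
  assumes "x \<in> proj_space F n"
  obtains u where "u \<in> unit_sphere F n" "x = proj_rel F n `` {u}"
  using assms unfolding proj_space_def by (auto elim: quotientE)

lemma proj_prod_self:
  assumes "F \<in> scalar_fields" "x \<in> proj_space F n"
  shows "proj_prod x x = 1"
  using assms(2)
proof (rule proj_space_memE)
  fix u assume u: "u \<in> unit_sphere F n" "x = proj_rel F n `` {u}"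
  then show ?thesis
    using proj_prod_class[OF assms(1) u(1) u(1)] by (simp add: unit_sphere_def)
qed

text \<open>Conjugation reverses products and preserves the norm, so swapping the arguments merely
  conjugates the Hermitian product. This makes the zonal matrices symmetric.\<close>

lemma proj_prod_commute:
  assumes "F \<in> scalar_fields" "x \<in> proj_space F n" "y \<in> proj_space F n"
  shows "proj_prod x y = proj_prod y x"
proof -
  obtain u v where u: "u \<in> unit_sphere F n" "x = proj_rel F n `` {u}"
    and v: "v \<in> unit_sphere F n" "y = proj_rel F n `` {v}"
    using assms(2,3) by (meson proj_space_memE)
  have cnj_mult: "quat_cnj (p * q) = quat_cnj q * quat_cnj p"
    and cnj_cnj: "quat_cnj (quat_cnj p) = p"
    and cnj_add: "quat_cnj (p + q) = quat_cnj p + quat_cnj q"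
    and cnj_0: "quat_cnj 0 = 0"
    and norm_cnj: "norm (quat_cnj p) = norm p" for p q
    by (simp_all add: quat_cnj_def norm_quat_def quat_simps algebra_simps)
  have cnj_sum: "quat_cnj (sum f A) = (\<Sum>i\<in>A. quat_cnj (f i))" for f :: "nat \<Rightarrow> quat" and A
    by (induction A rule: infinite_finite_induct) (simp_all add: cnj_add cnj_0)
  have "herm_prod u v = quat_cnj (herm_prod v u)"
    using u(1) v(1) by (auto simp: herm_prod_def cnj_sum cnj_mult cnj_cnj unit_sphere_def)
  then show ?thesis
    using proj_prod_class[OF assms(1) u(1) v(1)] proj_prod_class[OF assms(1) v(1) u(1)] u(2) v(2) norm_cnj
    by simp
qed

text \<open>The rank is the trace |X| P_i(1) / c, while the diagonal entry at \<open>y\<close> of M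
  M = c M says that c P_i(1) is the sum of squares. Multiplying eliminates \<open>c\<close>.\<close>

lemma rank_zonal_projection:
  assumes F: "F \<in> scalar_fields" and X: "X \<subseteq> proj_space F n" "y \<in> X"
    and xs: "distinct xs" "set xs = X"
    and c: "c > 0" "zonal_mat F n xs i * zonal_mat F n xs i = c \<cdot>\<^sub>m zonal_mat F n xs i"
  shows "real (vec_space.rank (card X) (inverse c \<cdot>\<^sub>m zonal_mat F n xs i))
      * (\<Sum>x\<in>X. (zonal F n i (proj_prod x y))\<^sup>2) = real (card X) * (zonal F n i 1)\<^sup>2"
proof -
  define M where "M = zonal_mat F n xs i"
  define k where "k = card X"
  have len: "length xs = k"
    unfolding k_def using xs distinct_card by metis
  have M: "M \<in> carrier_mat k k"
    unfolding M_def zonal_mat_def using len by auto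
  have self: "proj_prod x x = 1" if "x \<in> X" for x
    using F X(1) that proj_prod_self by blast
  have diag: "M $$ (j, j) = zonal F n i 1" if "j < k" for j
    using that len xs self nth_mem[of j xs] by (simp add: M_def zonal_mat_def)
  let ?L = "inverse c \<cdot>\<^sub>m M"
  have "?L * ?L = inverse c \<cdot>\<^sub>m (inverse c \<cdot>\<^sub>m (M * M))"
    using M by (simp add: mult_smult_distrib[of _ k k _ k] mult_smult_assoc_mat[of _ k k _ k])
  also have "\<dots> = ?L"
    using c M unfolding M_def[symmetric] by auto
  finally have idem: "?L * ?L = ?L" .
  have "?L \<in> carrier_mat k k"
    using M by simp
  from vec_space.rank_idempotent[OF this idem]
  have rank: "real (vec_space.rank k ?L) = inverse c * (real k * zonal F n i 1)"
    using M diag by simp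
  obtain j where j: "j < k" "xs ! j = y"
    using X(2) xs len by (metis in_set_conv_nth)
  have "(M * M) $$ (j, j) = (\<Sum>l<k. M $$ (j, l) * M $$ (l, j))"
    using M j by (auto simp: scalar_prod_def atLeast0LessThan)
  also have "\<dots> = (\<Sum>l<k. (zonal F n i (proj_prod (xs ! l) y))\<^sup>2)"
  proof (rule sum.cong)
    fix l assume "l \<in> {..<k}"
    then have "xs ! l \<in> X"
      using len xs nth_mem by blast
    then have "proj_prod y (xs ! l) = proj_prod (xs ! l) y"
      using proj_prod_commute[OF F] X by blast
    then show "M $$ (j, l) * M $$ (l, j) = (zonal F n i (proj_prod (xs ! l) y))\<^sup>2"
      using \<open>l \<in> {..<k}\<close> j len by (simp add: M_def zonal_mat_def power2_eq_square)
  qed simp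
  also have "\<dots> = (\<Sum>x\<in>X. (zonal F n i (proj_prod x y))\<^sup>2)"
    using bij_betw_nth[OF xs(1), of "{..<k}" X] len xs(2)
    by (intro sum.reindex_bij_betw) auto
  finally have diag_sq: "c * zonal F n i 1 = (\<Sum>x\<in>X. (zonal F n i (proj_prod x y))\<^sup>2)"
    unfolding c(2)[folded M_def] using j M diag[OF j(1)] by simp
  have "real (vec_space.rank k ?L) * (c * zonal F n i 1) = real k * (zonal F n i 1)\<^sup>2"
    using c(1) by (simp add: rank power2_eq_square)
  then show ?thesis
    unfolding diag_sq by (simp add: M_def k_def)
qed

section \<open>The equation between the ranks\<close>

text \<open>Passing from r to r + 1 multiplies the smaller side by (r + 1)(m + 1 + r) and the larger
  by (N + r)(b + 1 + r); these compare factor by factor, so r = 1 decides.\<close>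

lemma pochhammer_product_bound:
  fixes m b N :: real
  assumes "m \<ge> 0" "b \<ge> m" "N \<ge> 1" and base: "N * (b + 1) > (N + 1) * (m + 1)" and r: "r \<ge> 1"
  shows "pochhammer N r * pochhammer (b + 1) r > (N + 1) * fact r * pochhammer (m + 1) r"
  using r
proof (induction r rule: nat_induct_at_least)
  case (Suc r)
  have step: "real (Suc r) * (m + 1 + real r) \<le> (N + real r) * (b + 1 + real r)"
    using assms by (intro mult_mono) auto
  have pos: "0 < real (Suc r) * (m + 1 + real r)" "0 \<le> (N + 1) * fact r * pochhammer (m + 1) r"
    using assms pochhammer_pos[of "m + 1" r] by auto
  have "((N + 1) * fact r * pochhammer (m + 1) r) * (real (Suc r) * (m + 1 + real r)) <
      (pochhammer N r * pochhammer (b + 1) r) * ((N + real r) * (b + 1 + real r))"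
    by (rule mult_less_le_imp_less[OF Suc.IH step pos(2,1)])
  then show ?case
    by (simp add: pochhammer_Suc mult_ac)
qed (use base in simp)

lemma pochhammer_two_fact: "pochhammer 2 r = (fact (Suc r) :: real)"
  by (induction r) (simp_all add: pochhammer_Suc algebra_simps)

lemma pochhammer_four_fact: "6 * pochhammer 4 r = (fact (Suc (Suc (Suc r))) :: real)"
  by (induction r) (simp_all add: pochhammer_Suc algebra_simps)

text \<open>With b = m n the inequality at r = 1 is b^2 > m^2 + m + 1. It fails exactly for (m, n) =
  (1/2, 1), (1/2, 2), (1, 1), (2, 1), where a Pochhammer symbol cancels and an elementary equation
  remains.\<close>

lemma pochhammer_equation_solutions:
  fixes m :: real and n r :: nat
  assumes m: "m = 1 / 2 \<or> m = 1 \<or> m = 2" and n: "n \<ge> 1" and r: "r \<ge> 1"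
  defines "N \<equiv> m * (real n + 1)"
  shows "pochhammer N r * pochhammer (m * real n + 1) r = (N + 1) * fact r * pochhammer (m + 1) r
    \<longleftrightarrow> m = 1 \<and> n = 1 \<and> r = 2"
proof -
  have pos: "pochhammer (x :: real) r > 0" if "x > 0" for x
    using that by (rule pochhammer_pos)
  have bound: "pochhammer N r * pochhammer (m * real n + 1) r \<noteq> (N + 1) * fact r * pochhammer (m + 1) r"
    if "N * (m * real n + 1) > (N + 1) * (m + 1)"
  proof -
    have "m * real n \<ge> m * 1"
      using m n by (intro mult_left_mono) auto
    moreover have "N = m * real n + m"
      by (simp add: N_def algebra_simps)
    moreover have "m \<ge> 1 / 2"
      using m by auto
    ultimately have "m * real n \<ge> m" "N \<ge> 1" "m \<ge> 0"
      by linarith+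
    from pochhammer_product_bound[OF this(3,1,2) that r] show ?thesis
      by simp
  qed
  consider "m = 1 / 2" "n = 1" | "m = 1 / 2" "n = 2" | "m = 1 / 2" "n \<ge> 3"
    | "m = 1" "n = 1" | "m = 1" "n \<ge> 2" | "m = 2" "n = 1" | "m = 2" "n \<ge> 2"
    using m n by (metis One_nat_def Suc_1 le_antisym not_less_eq_eq numeral_3_eq_3)
  then show ?thesis
  proof cases
    case 1
    show ?thesis
      unfolding N_def 1 using pos[of "3 / 2"] by (simp add: pochhammer_fact[symmetric])
  next
    case 2
    \<comment> \<open>The equation is r + 1 = 5/2, excluded by parity.\<close>
    have "2 * (r + 1) \<noteq> 5"
      by presburger
    then have "real (2 * (r + 1)) \<noteq> real 5"
      by (simp only: of_nat_eq_iff not_False_eq_True)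
    then show ?thesis
      unfolding N_def 2 using pos[of "3 / 2"] by (auto simp: pochhammer_two_fact field_simps)
  next
    case 3
    then obtain k where "n = k + 3"
      using le_Suc_ex by (metis add.commute)
    then have "N * (m * real n + 1) > (N + 1) * (m + 1)"
      unfolding N_def 3(1) by (simp add: field_simps add_pos_nonneg)
    moreover have "m \<noteq> 1"
      using 3 by simp
    ultimately show ?thesis
      using bound by blast
  next
    case 4
    \<comment> \<open>The equation is r + 1 = 3, the exceptional solution.\<close>
    show ?thesis
      unfolding N_def 4 using pos[of 2] by (auto simp: pochhammer_two_fact)
  next
    case 5
    then obtain k where "n = k + 2"
      using le_Suc_ex by (metis add.commute)
    then have "N * (m * real n + 1) > (N + 1) * (m + 1)"
      unfolding N_def 5(1) by (simp add: field_simps add_pos_nonneg)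
    then show ?thesis
      using bound 5 by simp
  next
    case 6
    \<comment> \<open>The equation is (r + 1)(r + 2)(r + 3) = 30, strictly between the values 24 at
      r = 1 and 60 at r = 2.\<close>
    have "(r + 1) * (r + 2) * (r + 3) \<noteq> 30"
    proof (cases "r = 1")
      case False
      then have "(2 + 1) * (2 + 2) * (2 + 3) \<le> (r + 1) * (r + 2) * (r + 3)"
        using r by (intro mult_le_mono) auto
      then show ?thesis
        by simp
    qed simp
    then have "real (r + 1) * real (r + 2) * real (r + 3) \<noteq> 30"
      by (metis of_nat_eq_iff of_nat_mult of_nat_numeral)
    moreover have "6 * pochhammer 4 r = fact r * (real (r + 1) * real (r + 2) * real (r + 3))"
      using pochhammer_four_fact[of r] by (simp add: field_simps)
    ultimately have "6 * pochhammer 4 r \<noteq> fact r * (30 :: real)"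
      using mult_left_cancel[of "fact r :: real"] by simp
    then show ?thesis
      unfolding N_def 6 using pos[of 3] by auto
  next
    case 7
    then obtain k where "n = k + 2"
      using le_Suc_ex by (metis add.commute)
    then have "N * (m * real n + 1) > (N + 1) * (m + 1)"
      unfolding N_def 7(1) by (simp add: field_simps add_pos_nonneg)
    then show ?thesis
      using bound 7 by simp
  qed
qed

theorem theorem4p1:
  fixes F :: "quat set" and n s :: nat and X :: "quat vec set set" and xs :: "quat vec set list"
    and M L :: "nat \<Rightarrow> real mat" and \<kappa> :: "nat \<Rightarrow> real"
  assumes "F \<in> scalar_fields" and "n \<ge> 1" and "s \<ge> 2"
    and "tight_design F n (2 * s - 1) X"
    and "distinct xs" and "set xs = X"
    and "\<And>i. i \<le> s \<Longrightarrow> M i = zonal_mat F n xs i"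
    and "\<And>i. i \<le> s \<Longrightarrow> \<kappa> i > 0 \<and> M i * M i = \<kappa> i \<cdot>\<^sub>m M i"
    and "\<And>i. i \<le> s \<Longrightarrow> L i = inverse (\<kappa> i) \<cdot>\<^sub>m M i"
  shows "vec_space.rank (card X) (L s) = vec_space.rank (card X) (L 1) \<longleftrightarrow>
    F = quat_complexes \<and> n = 1 \<and> 2 * s - 1 = 5"
proof -
  define m where "m = half_dim F"
  define b where "b = m * real n"
  define P where "P = shifted_jacobi m b"
  have m: "m = 1 / 2 \<or> m = 1 \<or> m = 2"
    using assms(1) half_dim_scalar_fields by (auto simp: m_def scalar_fields_def)
  have m_complex: "m = 1 \<longleftrightarrow> F = quat_complexes"
    using assms(1) half_dim_scalar_fields by (auto simp: m_def scalar_fields_def)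
  have m0: "m > 0"
    using m by auto
  have b0: "b > 0"
    using m0 assms(2) by (simp add: b_def)
  have design: "design F n (2 * s - 1) X"
    and tight: "2 * s - 1 = card (angle_set X) + card (angle_set X - {0})"
    using assms(4) by (auto simp: tight_design_def)
  then have X: "finite X" "X \<noteq> {}" "X \<subseteq> proj_space F n"
    by (auto simp: design_def)
  then obtain y where y: "y \<in> X"
    by blast
  have fin_angle: "finite (angle_set X)"
    unfolding angle_set_def
    by (rule finite_subset[of _ "(\<lambda>(x, y). proj_prod x y) ` (X \<times> X)"]) (use X(1) in auto)
  \<comment> \<open>If 0 were no angle, the two cardinalities would agree and their sum could not be
    odd.\<close>
  have angle: "0 \<in> angle_set X" "card (angle_set X) = s"
  proof -
    show "0 \<in> angle_set X"
    proof (rule ccontr)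
      assume "0 \<notin> angle_set X"
      then have "2 * s - 1 = 2 * card (angle_set X)"
        using tight by simp
      then show False
        using assms(3) by presburger
    qed
    then have "card (angle_set X) > 0" "card (angle_set X - {0}) = card (angle_set X) - 1"
      using fin_angle by (auto simp: card_gt_0_iff)
    then show "card (angle_set X) = s"
      using tight by linarith
  qed
  have exact: "(\<Sum>x\<in>X. poly f (proj_prod x y)) = real (card X) * beta_mean m b f"
    if "degree f \<le> 2 * s - 1" for f
    unfolding m_def b_def
    using design_sum[OF _ assms(2) design y that] m0 by (simp add: m_def)
  have zonal: "zonal F n i \<xi> = poly (P i) \<xi>" for i \<xi>
    unfolding P_def b_def m_def
    using zonal_eq_shifted_jacobi[OF _ assms(2)] m0 by (simp add: m_def)
  have P1: "poly (P i) 1 = pochhammer b i / fact i" for i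
    unfolding P_def by (rule poly_shifted_jacobi_1[OF m0 b0])
  have rank: "real (vec_space.rank (card X) (L i)) * (\<Sum>x\<in>X. (poly (P i) (proj_prod x y))\<^sup>2)
      = real (card X) * (poly (P i) 1)\<^sup>2" if "i \<le> s" for i
    using rank_zonal_projection[OF assms(1) X(3) y assms(5,6), of "\<kappa> i" i] assms(7-9)[OF that]
    by (simp add: zonal P1)
  define v where "v = real (card X)"
  have v: "v > 0"
    using X by (simp add: v_def card_gt_0_iff)
  define r where "r = s - 1"
  have r: "s = Suc r" "r \<ge> 1"
    using assms(3) by (auto simp: r_def)
  define N where "N = m + b"
  have N: "N > 0"
    using m0 b0 by (simp add: N_def)
  have pos: "pochhammer (x :: real) j > 0" if "x > 0" for x j
    using that by (rule pochhammer_pos)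
  have sum_s: "(\<Sum>x\<in>X. (poly (P s) (proj_prod x y))\<^sup>2) =
      v * coeff (P s) s * jacobi_moment m b s * ((2 * real s + m + b - 1) / real s)"
    unfolding P_def v_def
  proof (rule lobatto_sum_shifted_jacobi_square[OF m0 b0 _ X(1) y _ _ fin_angle angle(2,1)])
    show "proj_prod y y = 1"
      using proj_prod_self[OF assms(1)] X(3) y by blast
    show "proj_prod x y \<in> angle_set X" if "x \<in> X" "x \<noteq> y" for x
      using that y by (auto simp: angle_set_def)
  qed (use assms(3) exact in auto)
  \<comment> \<open>P_1^2 has degree 2, within the exactness 2s - 1 because s \<ge> 2.\<close>
  have sum_1: "(\<Sum>x\<in>X. (poly (P 1) (proj_prod x y))\<^sup>2) = v * coeff (P 1) 1 * jacobi_moment m b 1"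
  proof -
    have "degree ((P 1)\<^sup>2) \<le> 2 * s - 1"
      using degree_mult_le[of "P 1" "P 1"] assms(3)
      by (simp add: P_def degree_shifted_jacobi[OF m0 b0] power2_eq_square)
    from exact[OF this] show ?thesis
      by (simp add: P_def v_def beta_mean_shifted_jacobi_square[OF m0 b0])
  qed
  have rank_1: "real (vec_space.rank (card X) (L 1)) = b * (N + 1) / m"
  proof -
    have "coeff (P 1) 1 = N" "jacobi_moment m b 1 = b * m / (N * (N + 1))"
      by (simp_all add: P_def coeff_shifted_jacobi[OF m0 b0] jacobi_moment_def[OF m0 b0] N_def
        pochhammer_Suc numeral_2_eq_2)
    then have "coeff (P 1) 1 * jacobi_moment m b 1 = b * m / (N + 1)"
      using N by simp
    then have "real (vec_space.rank (card X) (L 1)) * (v * (b * m / (N + 1))) = v * b\<^sup>2"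
      using rank[of 1] assms(3) unfolding sum_1 P1 v_def[symmetric] by (simp add: mult.assoc)
    moreover have "N + 1 > 0"
      using N by simp
    ultimately have "(v * b) * (real (vec_space.rank (card X) (L 1)) * m) = (v * b) * (b * (N + 1))"
      by (simp add: field_simps power2_eq_square)
    then have "real (vec_space.rank (card X) (L 1)) * m = b * (N + 1)"
      using v b0 by (subst (asm) mult_left_cancel) auto
    then show ?thesis
      using m0 by (simp add: field_simps)
  qed
  \<comment> \<open>Dictionary for the use below: \<open>A\<close> = (N + r)_s, \<open>B\<close> =
    (b)_s, \<open>D\<close> = 2s + N - 1, \<open>M\<close> = (m)_s, \<open>Q\<close> = (N)_r,
    \<open>S\<close> = s, \<open>f\<close> = r!. The equation is R M / Q = B / f times the common
    factor \<open>k\<close>.\<close>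
  have cancel: "R = B * Q / (f * M)"
    if eq: "R * (v * (A / (S * f) * (B * M / (Q * (A * D))) * (D / S))) = v * (B / (S * f))\<^sup>2"
      and "A > 0" "B > 0" "D > 0" "M > 0" "Q > 0" "S > 0" "f > 0" for R A B D M Q S f :: real
  proof -
    define k where "k = v * B / (S * S * f)"
    have "k > 0"
      using v that by (simp add: k_def)
    have "A / (S * f) * (B * M / (Q * (A * D))) * (D / S) = B * M / (S * S * f * Q)"
      using that by (simp add: field_simps)
    then have "k * (R * M / Q) = v * (B / (S * f))\<^sup>2"
      unfolding eq[symmetric] by (simp add: k_def mult_ac)
    also have "\<dots> = k * (B / f)"
      by (simp add: k_def power2_eq_square mult_ac)
    finally have "R * M / Q = B / f"
      using \<open>k > 0\<close> by (subst (asm) mult_left_cancel) auto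
    then show ?thesis
      using that by (simp add: field_simps)
  qed
  have rank_s: "real (vec_space.rank (card X) (L s)) = pochhammer b s * pochhammer N r / (fact r * pochhammer m s)"
  proof -
    let ?R = "real (vec_space.rank (card X) (L s))"
    \<comment> \<open>The split at r isolates (N + r)_s, the numerator of the leading coefficient,
      and 2s + N - 1, the numerator of the error factor; both cancel.\<close>
    have "pochhammer N (2 * s) = pochhammer N r * pochhammer (N + real r) (s + 1)"
      using pochhammer_product'[of N r "s + 1"] r by (simp add: mult_2)
    also have "pochhammer (N + real r) (s + 1) = pochhammer (N + real r) s * (2 * real s + N - 1)"
      using r by (simp add: pochhammer_Suc algebra_simps)
    finally have N2: "pochhammer N (2 * s) = pochhammer N r * (pochhammer (N + real r) s * (2 * real s + N - 1))" .
    have ends: "real s + m + b - 1 = N + real r" "2 * real s + m + b - 1 = 2 * real s + N - 1"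
      using r by (simp_all add: N_def)
    have "coeff (P s) s = pochhammer (N + real r) s / fact s"
      unfolding P_def coeff_shifted_jacobi[OF m0 b0] ends ..
    moreover have "jacobi_moment m b s = pochhammer b s * pochhammer m s / pochhammer N (2 * s)"
      unfolding jacobi_moment_def[OF m0 b0] N_def ..
    moreover have "fact s = (real s * fact r :: real)"
      using r by simp
    ultimately have "?R * (v * (pochhammer (N + real r) s / (real s * fact r)
        * (pochhammer b s * pochhammer m s / (pochhammer N r * (pochhammer (N + real r) s * (2 * real s + N - 1))))
        * ((2 * real s + N - 1) / real s)))
        = v * (pochhammer b s / (real s * fact r))\<^sup>2"
      using rank[of s] unfolding sum_s P1 v_def[symmetric] N2[symmetric] ends by (simp only: mult.assoc)
    then show ?thesis
      by (rule cancel) (use r N m0 b0 in \<open>auto intro!: pos add_pos_nonneg\<close>)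
  qed
  have "vec_space.rank (card X) (L s) = vec_space.rank (card X) (L 1) \<longleftrightarrow>
      pochhammer b s * pochhammer N r / (fact r * pochhammer m s) = b * (N + 1) / m"
    unfolding rank_1[symmetric] rank_s[symmetric] by simp
  also have "\<dots> \<longleftrightarrow> pochhammer N r * pochhammer (b + 1) r = (N + 1) * fact r * pochhammer (m + 1) r"
  proof -
    \<comment> \<open>(b)_s = b (b + 1)_r and likewise for \<open>m\<close>, so both ranks share the
      factor b/m.\<close>
    have e1: "pochhammer b s * pochhammer N r / (fact r * pochhammer m s) =
        b / m * (pochhammer N r * pochhammer (b + 1) r / (fact r * pochhammer (m + 1) r))"
      unfolding r(1) pochhammer_rec by (simp add: mult_ac)
    have e2: "b * (N + 1) / m = b / m * (N + 1)"
      by simp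
    have nz: "b / m \<noteq> 0" "fact r * pochhammer (m + 1) r \<noteq> 0"
      using m0 b0 pos[of "m + 1" r] by auto
    show ?thesis
      unfolding e1 e2 by (simp only: mult_left_cancel[OF nz(1)] nonzero_divide_eq_eq[OF nz(2)] mult.assoc)
  qed
  also have "\<dots> \<longleftrightarrow> m = 1 \<and> n = 1 \<and> r = 2"
    using pochhammer_equation_solutions[OF m assms(2) r(2)] by (simp add: N_def b_def algebra_simps)
  finally show ?thesis
    using m_complex r by auto
qed

end
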